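(* Let $G=(V,E\cup A)$ be a mixed graph and $k\ge1$ an integer such that $E\cup A$ can be partitioned into $k$ mixed edge covers. Then $E\cup A$ can be partitioned into $k$ mixed edge covers $F_1,\dots,F_k$ such that, writing $N_i:=F_i\cap E$ and $B_i:=F_i\cap A$, for every $i,j\in\{1,\dots,k\}$ we have $\big||F_i|-|F_j|\big|\le 2$, $\big||N_i|-|N_j|\big|\le 1$, and $\big||B_i|-|B_j|\big|\le 2$.
   Context: A mixed graph $G=(V,E\cup A)$ has a finite vertex set $V$, a set $E$ of undirected edges and a set $A$ of directed arcs; there are no loops, but parallel edges/arcs are allowed. A mixed edge cover is a subset $F\subseteq E\cup A$ such that for every $v\in V$ there is a directed path (possibly of length $0$) using only arcs of $F\cap A$ from an endpoint of some edge $e\in F\cap E$ to $v$. *)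

theory Defs
  imports "Graph_Theory.Digraph" "Graph_Theory.Arc_Walk" "HOL-Library.Disjoint_Sets"
begin

text \<open>
  A mixed graph is a finite loopless multi-digraph \<open>D\<close> carrying the vertices and the arcs, together
  with a finite set \<open>E\<close> of undirected edges; \<open>ends e\<close> is the set of the two endpoints of \<open>e\<close>.
  Edges and arcs are identifiers from one common type, so parallel ones are allowed, and a subset
  of \<open>E \<union> arcs D\<close> may contain both kinds.  Finiteness of \<open>E\<close> and \<open>arcs D\<close> is required
  explicitly, as it does not follow from that of the vertex set.
\<close>

locale mixed_graph = fin_digraph D + loopfree_digraph D
  for D :: "('v, 'e) pre_digraph" +
  fixes E :: "'e set" and ends :: "'e \<Rightarrow> 'v set"
  assumes finite_edges: "finite E"
    and edges_arcs_disjoint: "E \<inter> arcs D = {}"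
    and ends_in_verts: "e \<in> E \<Longrightarrow> ends e \<subseteq> verts D"
    and no_edge_loops: "e \<in> E \<Longrightarrow> card (ends e) = 2"

definition mixed_edge_cover ::
    "('v, 'e) pre_digraph \<Rightarrow> 'e set \<Rightarrow> ('e \<Rightarrow> 'v set) \<Rightarrow> 'e set \<Rightarrow> bool" where
  "mixed_edge_cover D E ends F \<longleftrightarrow>
     F \<subseteq> E \<union> arcs D \<and>
     (\<forall>v\<in>verts D. \<exists>e\<in>F \<inter> E. \<exists>u\<in>ends e. \<exists>p.
        pre_digraph.apath (D\<lparr>arcs := F \<inter> arcs D\<rparr>) u p v)"

text \<open>
  The parts are an indexed family rather than a set of sets: exactly \<open>k\<close> parts are required, and
  they may be empty (which is possible only for the graph without vertices).
\<close>

definition mixed_edge_cover_partition ::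
    "('v, 'e) pre_digraph \<Rightarrow> 'e set \<Rightarrow> ('e \<Rightarrow> 'v set) \<Rightarrow> nat \<Rightarrow> (nat \<Rightarrow> 'e set) \<Rightarrow> bool" where
  "mixed_edge_cover_partition D E ends k F \<longleftrightarrow>
     (\<forall>i\<in>{1..k}. mixed_edge_cover D E ends (F i)) \<and>
     disjoint_family_on F {1..k} \<and>
     (\<Union>i\<in>{1..k}. F i) = E \<union> arcs D"

end

(* Reachability in a mixed edge cover is a cut condition, so by Edmonds' theorem two covers may
   exchange edges as long as every minimal set of vertices that no arc of either enters is still
   met by both edge sets: a set entered by only one arc is met by an edge of either part in any case.
   Link the two edge ends by which such a set, or a vertex, is met from both sides.  The links
   join the edges into alternating paths and cycles; flipping these balances the numbers of edges
   and of roots at once, which gives the statement for k = 2.  For general k, a partition that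
   minimises the sum of 3 |N_i|^2 + |B_i|^2 + |F_i|^2 has only balanced pairs. *)

theory Submission
  imports Defs
begin

section \<open>Balancing signs along links\<close>

text \<open>Roots are balanced because they govern arc numbers. With root set \<open>R\<close>, a
  part needs at least |V - R| arcs, that many can suffice, and surplus arcs may go to either part.
  Two parts with \<open>m1\<close> and \<open>m2\<close> non-roots that share \<open>n\<close> arcs
  thus admit every split b + (n - b) with m1 \<le> b \<le> n - m2. If n > m1 + m2, a root difference
  of at most 2 leaves room for an equal split up to rounding. If n = m1 + m2, the split is forced,
  the arc difference is minus the root difference t, and the total difference is e - t, where e is
  the edge difference. Hence |e|, |t| and |t - e| must be controlled together. The obstacle is that
  the number of vertices met by a set of edges is not additive. Root sets may therefore be smaller
  than the sets of endpoints: a vertex met from both sides is linked and stays a root of both parts,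
  any other vertex is a root of one part only, decided by one chosen end. Then t is a sum of signs,
  and since a path has only two free ends, few pairs (e, t) can arise from it.\<close>

lemma exists_balanced_signs:
  assumes "finite A"
  shows "\<exists>\<sigma>::'a \<Rightarrow> int. range \<sigma> \<subseteq> {1, -1} \<and> (\<Sum>x\<in>A. \<sigma> x) \<in> {0, 1}"
  using assms
proof (induction A rule: finite_induct)
  case empty
  show ?case by (intro exI[of _ "\<lambda>_. 1"]) auto
next
  case (insert x A)
  then obtain \<sigma> :: "'a \<Rightarrow> int" where \<sigma>: "range \<sigma> \<subseteq> {1, -1}" "(\<Sum>x\<in>A. \<sigma> x) \<in> {0, 1}" by blast
  have "(\<Sum>y\<in>A. (\<sigma>(x := s)) y) = (\<Sum>y\<in>A. \<sigma> y)" for s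
    using insert.hyps by (intro sum.cong) auto
  then have "(\<Sum>y\<in>insert x A. (\<sigma>(x := s)) y) = s + (\<Sum>y\<in>A. \<sigma> y)" for s
    using insert.hyps by simp
  \<comment> \<open>The new sign steers the sum back into {0, 1}. The one-sided range means that a
    type later leaves either nothing or one positive copy.\<close>
  then show ?case using \<sigma>
    by (intro exI[of _ "\<sigma>(x := if (\<Sum>x\<in>A. \<sigma> x) = 0 then 1 else -1)"]) auto
qed

text \<open>Up to sign, the nonzero types of \<open>(e x, t x)\<close> are \<open>(1,0)\<close>, \<open>(1,1)\<close>, \<open>(1,2)\<close> and \<open>(0,1)\<close>; two
  elements of the same type cancel, which leaves at most one of each type.\<close>

lemma exists_signs_two_sums:
  fixes e t :: "'a \<Rightarrow> int"
  assumes fin: "finite A"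
    and types: "\<And>x. x \<in> A \<Longrightarrow> (e x = 0 \<and> \<bar>t x\<bar> \<le> 1) \<or> (\<bar>e x\<bar> = 1 \<and> e x * t x \<in> {0, 1, 2})"
  shows "\<exists>\<sigma>. range \<sigma> \<subseteq> {1, -1} \<and> (let e' = \<Sum>x\<in>A. \<sigma> x * e x; t' = \<Sum>x\<in>A. \<sigma> x * t x
    in \<bar>e'\<bar> \<le> 1 \<and> \<bar>t'\<bar> \<le> 2 \<and> \<bar>t' - e'\<bar> \<le> 2)"
proof -
  define s :: "'a \<Rightarrow> int" where "s x = (if e x < 0 \<or> e x = 0 \<and> t x < 0 then -1 else 1)" for x
  define T where "T p q = {x \<in> A. s x * e x = p \<and> s x * t x = q}" for p q
  have s: "s x = 1 \<or> s x = -1" for x by (simp add: s_def)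
  obtain \<sigma> :: "int \<Rightarrow> int \<Rightarrow> 'a \<Rightarrow> int"
    where \<sigma>: "\<And>p q. range (\<sigma> p q) \<subseteq> {1, -1}" "\<And>p q. (\<Sum>x\<in>T p q. \<sigma> p q x) \<in> {0, 1}"
  proof -
    have "\<forall>p q. \<exists>\<sigma>::'a \<Rightarrow> int. range \<sigma> \<subseteq> {1, -1} \<and> (\<Sum>x\<in>T p q. \<sigma> x) \<in> {0, 1}"
      using fin by (intro allI exists_balanced_signs) (simp add: T_def)
    then show thesis using that by metis
  qed
  define n where "n p q = (\<Sum>x\<in>T p q. \<sigma> p q x)" for p q
  have n: "n p q \<in> {0, 1}" for p q using \<sigma>(2) by (simp add: n_def)
  have A: "A = T 0 0 \<union> (T 0 1 \<union> (T 1 0 \<union> (T 1 1 \<union> T 1 2)))"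
  proof (intro equalityI subsetI)
    fix x assume "x \<in> A"
    have "(s x * e x, s x * t x) \<in> {(0,0), (0,1), (1,0), (1,1), (1,2)}"
      using types[OF \<open>x \<in> A\<close>] by (auto simp: s_def)
    with \<open>x \<in> A\<close> show "x \<in> T 0 0 \<union> (T 0 1 \<union> (T 1 0 \<union> (T 1 1 \<union> T 1 2)))"
      by (auto simp: T_def)
  qed (auto simp: T_def)
  have finT: "finite (T p q)" for p q using fin by (simp add: T_def)
  have dis: "T p q \<inter> T p' q' = {}" if "(p, q) \<noteq> (p', q')" for p q p' q'
    using that by (auto simp: T_def)
  \<comment> \<open>A product of three signs: \<open>s\<close> normalises the type of
    \<open>x\<close>, \<sigma> cancels within a type, and \<epsilon> orients what the type leaves
    over.\<close>
  define \<rho> where "\<rho> \<epsilon> x = s x * \<epsilon> (s x * e x) (s x * t x) * \<sigma> (s x * e x) (s x * t x) x"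
    for \<epsilon> :: "int \<Rightarrow> int \<Rightarrow> int" and x
  have sums: "(\<Sum>x\<in>T p q. \<rho> \<epsilon> x * e x) = p * \<epsilon> p q * n p q"
    "(\<Sum>x\<in>T p q. \<rho> \<epsilon> x * t x) = q * \<epsilon> p q * n p q" for \<epsilon> p q
    unfolding n_def sum_distrib_left
    by (auto simp: T_def \<rho>_def intro!: sum.cong)
  have split: "(\<Sum>x\<in>A. f x) = (\<Sum>x\<in>T 0 0. f x) + ((\<Sum>x\<in>T 0 1. f x) + ((\<Sum>x\<in>T 1 0. f x)
    + ((\<Sum>x\<in>T 1 1. f x) + (\<Sum>x\<in>T 1 2. f x))))" for f :: "'a \<Rightarrow> int"
    unfolding A by (subst sum.union_disjoint; (simp add: finT dis Int_Un_distrib)?)+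
  \<comment> \<open>At most one vector each of (0,1), (1,0), (1,1), (1,2) is left. Signs alternate
    along those of the last three that are present, and (0,1) is positive. A lone (1,2) is negative,
    since (1,2) + (0,1) would have second entry 3.\<close>
  have main: "\<exists>a b c d. {a, b, c, d} \<subseteq> {1, -1 :: int} \<and> (let e' = b * n 1 0 + c * n 1 1 + d * n 1 2;
      t' = a * n 0 1 + c * n 1 1 + 2 * d * n 1 2
      in \<bar>e'\<bar> \<le> 1 \<and> \<bar>t'\<bar> \<le> 2 \<and> \<bar>t' - e'\<bar> \<le> 2)"
    by (rule exI[of _ 1], rule exI[of _ 1], rule exI[of _ "if n 1 0 = 1 then -1 else 1"],
        rule exI[of _ "if n 1 0 = 1 \<and> n 1 1 = 1 then 1 else -1"])
      (use n[of 0 1] n[of 1 0] n[of 1 1] n[of 1 2] in auto)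
  then obtain a b c d where abcd: "{a, b, c, d} \<subseteq> {1, -1 :: int}" "let e' = b * n 1 0 + c * n 1 1 + d * n 1 2;
      t' = a * n 0 1 + c * n 1 1 + 2 * d * n 1 2
      in \<bar>e'\<bar> \<le> 1 \<and> \<bar>t'\<bar> \<le> 2 \<and> \<bar>t' - e'\<bar> \<le> 2" by blast
  define \<epsilon> where "\<epsilon> p q = (if p = 0 then a else if q = 0 then b else if q = 1 then c else d)" for p q :: int
  have "\<epsilon> p q \<in> {1, -1}" for p q using abcd(1) by (simp add: \<epsilon>_def)
  then have "\<rho> \<epsilon> x \<in> {1, -1}" for x
    using s[of x] \<sigma>(1) unfolding \<rho>_def
    by (smt (verit) insertE insertI1 insertI2 insert_absorb insert_not_empty mult_cancel_left1 mult_minus1 mult_minus_right rangeI singletonD subsetD)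
  moreover have "(\<Sum>x\<in>A. \<rho> \<epsilon> x * e x) = b * n 1 0 + c * n 1 1 + d * n 1 2"
    "(\<Sum>x\<in>A. \<rho> \<epsilon> x * t x) = a * n 0 1 + c * n 1 1 + 2 * d * n 1 2"
    unfolding split sums by (simp_all add: \<epsilon>_def)
  ultimately show ?thesis
    using abcd(2) by (intro exI[of _ "\<rho> \<epsilon>"]) auto
qed

text \<open>Each item starts as its own block with at most two free ends. A link between two blocks
  merges them and uses up one free end of each, so at most 2 + 2 - 2 remain; a link inside a block
  closes a cycle and creates no free end. The blocks are the alternating paths and cycles.\<close>

lemma exists_blocks:
  fixes own :: "'h \<Rightarrow> 'e"
  assumes "finite L" "finite H" "L \<subseteq> H \<times> H" "inj_on fst L" "inj_on snd L" "fst ` L \<inter> snd ` L = {}"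
    and two: "\<And>x. card {h \<in> H. own h = x} \<le> 2"
  shows "\<exists>block :: 'e \<Rightarrow> 'e. (\<forall>(h, h')\<in>L. block (own h) = block (own h')) \<and>
    (\<forall>b. card {h \<in> H - fst ` L - snd ` L. block (own h) = b} \<le> 2)"
  using assms(1,3-6)
proof (induction L rule: finite_induct)
  case empty
  show ?case using two by (intro exI[of _ "\<lambda>x. x"]) auto
next
  case (insert l L)
  obtain h h' where l: "l = (h, h')" by (cases l)
  have "\<exists>block :: 'e \<Rightarrow> 'e. (\<forall>(h, h')\<in>L. block (own h) = block (own h')) \<and>
    (\<forall>b. card {h \<in> H - fst ` L - snd ` L. block (own h) = b} \<le> 2)"
    using insert.prems by (intro insert.IH) auto
  then obtain block :: "'e \<Rightarrow> 'e" where IH: "\<And>h h'. (h, h') \<in> L \<Longrightarrow> block (own h) = block (own h')"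
    "\<And>b. card {h \<in> H - fst ` L - snd ` L. block (own h) = b} \<le> 2" by blast
  let ?U = "\<lambda>b. {h \<in> H - fst ` L - snd ` L. block (own h) = b}"
  have fin: "finite (?U b)" for b using assms(2) by simp
  define block' where "block' x = (if block x = block (own h') then block (own h) else block x)" for x
  let ?U' = "\<lambda>b. {h \<in> H - fst ` insert l L - snd ` insert l L. block' (own h) = b}"
  have hh: "h \<in> ?U (block (own h))" "h' \<in> ?U (block (own h'))"
  proof -
    have "h \<notin> fst ` L" "h' \<notin> snd ` L"
      using insert.prems(2,3) insert.hyps(2) l by (simp_all add: inj_on_insert)
    moreover have "h \<notin> snd ` L" "h' \<notin> fst ` L" "h \<in> H" "h' \<in> H"
      using insert.prems l by auto
    ultimately show "h \<in> ?U (block (own h))" "h' \<in> ?U (block (own h'))" by auto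
  qed
  have "card (?U' b) \<le> 2" for b
  proof (cases "b = block (own h) \<and> block (own h) \<noteq> block (own h')")
    case True
    have "?U' b \<subseteq> (?U (block (own h)) - {h}) \<union> (?U (block (own h')) - {h'})"
      using True l by (auto simp: block'_def split: if_splits)
    then have "card (?U' b) \<le> card (?U (block (own h)) - {h}) + card (?U (block (own h')) - {h'})"
      using fin by (meson card_Un_le card_mono finite_Diff finite_UnI order_trans)
    also have "\<dots> \<le> 1 + 1"
      unfolding card_Diff_singleton[OF hh(1)] card_Diff_singleton[OF hh(2)]
      using IH(2)[of "block (own h)"] IH(2)[of "block (own h')"] by linarith
    finally show ?thesis by simp
  next
    case False
    then have "?U' b \<subseteq> ?U b" using l by (auto simp: block'_def split: if_splits)
    from card_mono[OF fin this] IH(2)[of b] show ?thesis by linarith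
  qed
  moreover have "\<forall>(h, h')\<in>insert l L. block' (own h) = block' (own h')"
    using IH(1) l by (auto simp: block'_def)
  ultimately show ?case by blast
qed

text \<open>Joining items along linked ends yields blocks with at most two free ends. Reversing the signs
  of a whole block keeps the links alternating, and the free ends of a block determine its type.\<close>

lemma exists_balanced_linked_signs:
  fixes \<chi> :: "'e \<Rightarrow> int" and own :: "'h \<Rightarrow> 'e"
  assumes fin: "finite E" "finite H" and own: "own ` H \<subseteq> E"
    and two: "\<And>x. x \<in> E \<Longrightarrow> card {h \<in> H. own h = x} = 2"
    and \<chi>: "\<And>x. x \<in> E \<Longrightarrow> \<chi> x \<in> {1, -1}"
    and L: "L \<subseteq> H \<times> H" "inj_on fst L" "inj_on snd L"
    and alt: "\<And>h h'. (h, h') \<in> L \<Longrightarrow> \<chi> (own h) = 1 \<and> \<chi> (own h') = -1"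
    and T: "T \<subseteq> H - fst ` L - snd ` L"
  shows "\<exists>\<chi>' :: 'e \<Rightarrow> int. (\<forall>x\<in>E. \<chi>' x \<in> {1, -1}) \<and> (\<forall>(h, h')\<in>L. \<chi>' (own h') = - \<chi>' (own h)) \<and>
    (let e' = \<Sum>x\<in>E. \<chi>' x; t' = \<Sum>h\<in>T. \<chi>' (own h)
      in \<bar>e'\<bar> \<le> 1 \<and> \<bar>t'\<bar> \<le> 2 \<and> \<bar>t' - e'\<bar> \<le> 2)"
proof -
  have finL: "finite L" and finT: "finite T"
    using fin(2) L(1) T by (auto intro: finite_subset)
  have "\<chi> (own h) = 1" if "h \<in> fst ` L" for h using that alt by auto
  moreover have "\<chi> (own h) = -1" if "h \<in> snd ` L" for h using that alt by auto
  ultimately have disj: "fst ` L \<inter> snd ` L = {}" by (force simp: disjoint_iff)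
  have "card {h \<in> H. own h = x} \<le> 2" for x
  proof (cases "x \<in> E")
    case False
    then have "{h \<in> H. own h = x} = {}" using own by auto
    then show ?thesis by (metis card.empty zero_le)
  qed (use two in simp)
  then obtain block :: "'e \<Rightarrow> 'e" where block: "\<And>h h'. (h, h') \<in> L \<Longrightarrow> block (own h) = block (own h')"
    "\<And>b. card {h \<in> H - fst ` L - snd ` L. block (own h) = b} \<le> 2"
    using exists_blocks[OF finL fin(2) L disj, of own] by blast
  define e where "e b = (\<Sum>x | x \<in> E \<and> block x = b. \<chi> x)" for b
  define t where "t b = (\<Sum>h | h \<in> T \<and> block (own h) = b. \<chi> (own h))" for b
  have types: "(e b = 0 \<and> \<bar>t b\<bar> \<le> 1) \<or> (\<bar>e b\<bar> = 1 \<and> e b * t b \<in> {0, 1, 2})" for b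
  proof -
    define U where "U = {h \<in> H - fst ` L - snd ` L. block (own h) = b}"
    define Lb where "Lb = {(h, h') \<in> L. block (own h) = b}"
    have Lb: "finite Lb" "Lb \<subseteq> L" using finL by (auto simp: Lb_def intro: finite_subset)
    let ?H = "{h \<in> H. block (own h) = b}"
    \<comment> \<open>Double counting: every item has two ends, so twice the item sum is the sum
      over all ends. Linked ends have opposite signs, and only the free ends \<open>U\<close>
      survive.\<close>
    have "2 * e b = (\<Sum>x | x \<in> E \<and> block x = b. \<Sum>h | h \<in> ?H \<and> own h = x. \<chi> (own h))"
      unfolding e_def sum_distrib_left
    proof (rule sum.cong)
      fix x assume x: "x \<in> {x. x \<in> E \<and> block x = b}"
      then have "{h. h \<in> ?H \<and> own h = x} = {h \<in> H. own h = x}" by auto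
      then show "2 * \<chi> x = (\<Sum>h | h \<in> ?H \<and> own h = x. \<chi> (own h))"
        using two[of x] x by simp
    qed simp
    also have "\<dots> = (\<Sum>h\<in>?H. \<chi> (own h))"
      using own by (intro sum.group) (auto simp: fin)
    also have "?H = U \<union> (fst ` Lb \<union> snd ` Lb)"
    proof (intro equalityI subsetI)
      fix h assume h: "h \<in> ?H"
      show "h \<in> U \<union> (fst ` Lb \<union> snd ` Lb)"
      proof (cases "h \<in> U")
        case False
        with h obtain l where "l \<in> L" "h = fst l \<or> h = snd l" by (auto simp: U_def)
        with h block(1)[of "fst l" "snd l"] have "l \<in> Lb" by (auto simp: Lb_def)
        with \<open>h = fst l \<or> h = snd l\<close> show ?thesis by auto
      qed simp
    next
      fix h assume "h \<in> U \<union> (fst ` Lb \<union> snd ` Lb)"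
      then show "h \<in> ?H" using block(1) L(1) by (fastforce simp: U_def Lb_def)
    qed
    also have "(\<Sum>h\<in>\<dots>. \<chi> (own h)) = (\<Sum>h\<in>U. \<chi> (own h)) + ((\<Sum>h\<in>fst ` Lb. \<chi> (own h)) + (\<Sum>h\<in>snd ` Lb. \<chi> (own h)))"
    proof -
      have "finite U" using fin by (simp add: U_def)
      moreover have "U \<inter> (fst ` Lb \<union> snd ` Lb) = {}" "fst ` Lb \<inter> snd ` Lb = {}"
        using Lb(2) disj by (auto simp: U_def)
      ultimately show ?thesis using Lb(1) by (simp add: sum.union_disjoint)
    qed
    also have "(\<Sum>h\<in>fst ` Lb. \<chi> (own h)) + (\<Sum>h\<in>snd ` Lb. \<chi> (own h)) = 0"
    proof -
      have "(\<Sum>h\<in>fst ` Lb. \<chi> (own h)) + (\<Sum>h\<in>snd ` Lb. \<chi> (own h))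
        = (\<Sum>l\<in>Lb. \<chi> (own (fst l)) + \<chi> (own (snd l)))"
        by (simp add: sum.reindex[OF inj_on_subset[OF L(2) Lb(2)]]
          sum.reindex[OF inj_on_subset[OF L(3) Lb(2)]] sum.distrib)
      also have "\<dots> = 0"
        using Lb(2) alt by (intro sum.neutral) fastforce
      finally show ?thesis .
    qed
    finally have e2: "2 * e b = (\<Sum>h\<in>U. \<chi> (own h))" by simp
    have "card U \<le> 2" using block(2) by (simp add: U_def)
    moreover have "finite U" using fin by (simp add: U_def)
    moreover have \<chi>U: "\<chi> (own h) \<in> {1, -1}" if "h \<in> U" for h
      using \<chi> own that by (auto simp: U_def)
    moreover have TU: "{h. h \<in> T \<and> block (own h) = b} \<subseteq> U" using T by (auto simp: U_def)
    ultimately consider "U = {}" | h where "U = {h}" | h h' where "U = {h, h'}" "h \<noteq> h'"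
      by (metis One_nat_def card_0_eq card_1_singletonE card_2_iff le_SucE le_zero_eq numeral_2_eq_2)
    then show ?thesis
    proof cases
      case 1
      with TU e2 have "e b = 0" "{h. h \<in> T \<and> block (own h) = b} = {}" by auto
      then show ?thesis by (simp only: t_def) simp
    next
      case (2 h)
      \<comment> \<open>Parity: a single free end would make an even number equal to 1 or
        -1.\<close>
      with \<chi>U[of h] e2 have "2 * e b = 1 \<or> 2 * e b = -1" by simp
      then have False by presburger
      then show ?thesis ..
    next
      case (3 h h')
      let ?Tb = "{h. h \<in> T \<and> block (own h) = b}"
      have "?Tb = {} \<or> ?Tb = {h} \<or> ?Tb = {h'} \<or> ?Tb = {h, h'}"
        using TU unfolding 3(1) by blast
      then have "t b \<in> {0, \<chi> (own h), \<chi> (own h'), \<chi> (own h) + \<chi> (own h')}"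
        unfolding t_def using 3(2) by (elim disjE; simp only:) simp_all
      \<comment> \<open>Equal signs give |e b| = 1 with \<open>t b\<close> among 0,
        \<open>e b\<close> and 2 \<open>e b\<close>; opposite signs give \<open>e b\<close> = 0 and
        |t b| \<le> 1.\<close>
      moreover have "2 * e b = \<chi> (own h) + \<chi> (own h')" using e2 3 by simp
      ultimately show ?thesis using \<chi>U[of h] \<chi>U[of h'] 3(1) by auto
    qed
  qed
  obtain \<sigma> where \<sigma>: "range \<sigma> \<subseteq> {1, -1}" "let e' = \<Sum>b\<in>block ` E. \<sigma> b * e b; t' = \<Sum>b\<in>block ` E. \<sigma> b * t b
    in \<bar>e'\<bar> \<le> 1 \<and> \<bar>t'\<bar> \<le> 2 \<and> \<bar>t' - e'\<bar> \<le> 2"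
    using exists_signs_two_sums[of "block ` E" e t] fin types by auto
  define \<chi>' where "\<chi>' x = \<sigma> (block x) * \<chi> x" for x
  have ownT: "own h \<in> E" if "h \<in> T" for h using that T own by blast
  have "(\<Sum>b\<in>block ` E. \<sigma> b * e b) = (\<Sum>b\<in>block ` E. \<Sum>x | x \<in> E \<and> block x = b. \<chi>' x)"
    by (auto simp: e_def \<chi>'_def sum_distrib_left intro!: sum.cong)
  also have "\<dots> = (\<Sum>x\<in>E. \<chi>' x)"
    using fin by (intro sum.group) auto
  finally have 1: "(\<Sum>b\<in>block ` E. \<sigma> b * e b) = (\<Sum>x\<in>E. \<chi>' x)" .
  have "(\<Sum>b\<in>block ` E. \<sigma> b * t b) = (\<Sum>b\<in>block ` E. \<Sum>h | h \<in> T \<and> block (own h) = b. \<chi>' (own h))"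
    by (auto simp: t_def \<chi>'_def sum_distrib_left intro!: sum.cong)
  also have "\<dots> = (\<Sum>h\<in>T. \<chi>' (own h))"
    using fin finT ownT by (intro sum.group) auto
  finally have 2: "(\<Sum>b\<in>block ` E. \<sigma> b * t b) = (\<Sum>h\<in>T. \<chi>' (own h))" .
  have \<sigma>1: "\<sigma> b = 1 \<or> \<sigma> b = -1" for b using \<sigma>(1) by auto
  show ?thesis
  proof (intro exI[of _ \<chi>'] conjI ballI)
    show "\<chi>' x \<in> {1, -1}" if "x \<in> E" for x
      using \<chi>[OF that] \<sigma>1[of "block x"] by (auto simp: \<chi>'_def)
    show "case l of (h, h') \<Rightarrow> \<chi>' (own h') = - \<chi>' (own h)" if "l \<in> L" for l
    proof (cases l)
      case (Pair h h')
      with that alt[of h h'] block(1)[of h h'] show ?thesis by (simp add: \<chi>'_def)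
    qed
    show "let e' = \<Sum>x\<in>E. \<chi>' x; t' = \<Sum>h\<in>T. \<chi>' (own h)
      in \<bar>e'\<bar> \<le> 1 \<and> \<bar>t'\<bar> \<le> 2 \<and> \<bar>t' - e'\<bar> \<le> 2"
      using \<sigma>(2) unfolding 1 2 .
  qed
qed

lemma sum_signs:
  fixes \<chi> :: "'a \<Rightarrow> int"
  assumes "finite A" "\<And>x. x \<in> A \<Longrightarrow> \<chi> x \<in> {1, -1}"
  shows "(\<Sum>x\<in>A. \<chi> x) = int (card {x \<in> A. \<chi> x = 1}) - int (card {x \<in> A. \<chi> x = -1})"
proof -
  have "(\<Sum>x\<in>A. \<chi> x) = (\<Sum>x\<in>A. (if \<chi> x = 1 then 1 else 0) - (if \<chi> x = -1 then 1 else 0))"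
    using assms(2) by (intro sum.cong) auto
  then show ?thesis using assms(1) by (simp add: sum_subtractf sum.If_cases Int_def)
qed

section \<open>Redistribution of edges and roots\<close>

text \<open>An end of an edge of \<open>N1\<close> is linked to an end of an edge of \<open>N2\<close> at each vertex that meets both, and
  likewise in each member of \<open>\<C>\<close> without such a vertex.  Each remaining vertex contributes to exactly one root
  set, decided by a single free end.\<close>

lemma exists_balanced_roots:
  fixes ends :: "'e \<Rightarrow> 'v set"
  assumes fin: "finite N1" "finite N2" and disj: "N1 \<inter> N2 = {}"
    and two: "\<And>x. x \<in> N1 \<union> N2 \<Longrightarrow> card (ends x) = 2"
    and \<C>: "\<And>C C'. C \<in> \<C> \<Longrightarrow> C' \<in> \<C> \<Longrightarrow> C \<noteq> C' \<Longrightarrow> C \<inter> C' = {}"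
    and meets: "\<And>C. C \<in> \<C> \<Longrightarrow> C \<inter> \<Union>(ends ` N1) \<noteq> {} \<and> C \<inter> \<Union>(ends ` N2) \<noteq> {}"
  shows "\<exists>M1 M2 R1 R2. M1 \<union> M2 = N1 \<union> N2 \<and> M1 \<inter> M2 = {} \<and>
    R1 \<subseteq> \<Union>(ends ` M1) \<and> R2 \<subseteq> \<Union>(ends ` M2) \<and> R1 \<union> R2 = \<Union>(ends ` N1) \<union> \<Union>(ends ` N2) \<and>
    (\<forall>C\<in>\<C>. C \<inter> R1 \<noteq> {} \<and> C \<inter> R2 \<noteq> {}) \<and>
    \<bar>int (card M1) - int (card M2)\<bar> \<le> 1 \<and> \<bar>int (card R1) - int (card R2)\<bar> \<le> 2 \<and>
    \<bar>(int (card R1) - int (card R2)) - (int (card M1) - int (card M2))\<bar> \<le> 2"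
proof -
  define N where "N = N1 \<union> N2"
  define V1 where "V1 = \<Union>(ends ` N1)"
  define V2 where "V2 = \<Union>(ends ` N2)"
  have finN: "finite N" using fin by (simp add: N_def)
  have fin_ends: "finite (ends x)" if "x \<in> N" for x
    using two[of x] that by (intro card_ge_0_finite) (simp add: N_def)
  have finV: "finite V1" "finite V2" using fin fin_ends by (auto simp: V1_def V2_def N_def)
  obtain g1 where g1: "\<And>v. v \<in> V1 \<Longrightarrow> g1 v \<in> N1 \<and> v \<in> ends (g1 v)"
    unfolding V1_def by (metis UN_E)
  obtain g2 where g2: "\<And>v. v \<in> V2 \<Longrightarrow> g2 v \<in> N2 \<and> v \<in> ends (g2 v)"
    unfolding V2_def by (metis UN_E)
  define \<C>0 where "\<C>0 = {C \<in> \<C>. C \<inter> V1 \<inter> V2 = {}}"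
  define p where "p C = (SOME v. v \<in> C \<inter> V1)" for C
  have p: "p C \<in> C \<inter> V1" if "C \<in> \<C>" for C
    using meets[OF that] unfolding p_def some_in_eq V1_def by blast
  define q where "q C = (SOME v. v \<in> C \<inter> V2)" for C
  have q: "q C \<in> C \<inter> V2" if "C \<in> \<C>" for C
    using meets[OF that] unfolding q_def some_in_eq V2_def by blast
  have p0: "p C \<in> C" "p C \<in> V1" "p C \<notin> V2" if "C \<in> \<C>0" for C using p[of C] that by (auto simp: \<C>0_def)
  have q0: "q C \<in> C" "q C \<notin> V1" "q C \<in> V2" if "C \<in> \<C>0" for C using q[of C] that by (auto simp: \<C>0_def)
  have eqC: "C = C'" if "C \<in> \<C>0" "C' \<in> \<C>0" "v \<in> C" "v \<in> C'" for C C' v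
    using \<C>[of C C'] that by (auto simp: \<C>0_def)
  have injp: "inj_on p \<C>0" and injq: "inj_on q \<C>0"
    using eqC p0(1) q0(1) by (metis inj_onI)+
  have fin\<C>0: "finite \<C>0"
    using inj_on_finite[OF injp _ finV(1)] p0(2) by blast
  \<comment> \<open>\<open>Q\<close> pairs a vertex met by \<open>N1\<close> with one met by
    \<open>N2\<close>; \<open>L\<close> pairs the chosen ends there, an end being an edge with one
    of its endpoints. No vertex is used twice on the same side: members of \<open>\<C>0\<close> are
    disjoint, and \<open>p C\<close>, \<open>q C\<close> lie outside
    \<open>V1 \<inter> V2\<close>.\<close>
  define Q where "Q = (\<lambda>v. (v, v)) ` (V1 \<inter> V2) \<union> (\<lambda>C. (p C, q C)) ` \<C>0"
  define L where "L = (\<lambda>(v, w). ((g1 v, v), (g2 w, w))) ` Q"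
  have QV: "v \<in> V1" "w \<in> V2" if "(v, w) \<in> Q" for v w using that p0 q0 by (auto simp: Q_def)
  have Q1: "w = w'" if "(v, w) \<in> Q" "(v, w') \<in> Q" for v w w'
    using that p0 by (auto simp: Q_def inj_on_eq_iff[OF injp])
  have Q2: "v = v'" if "(v, w) \<in> Q" "(v', w) \<in> Q" for v v' w
    using that q0 by (auto simp: Q_def inj_on_eq_iff[OF injq])
  define W where "W = (V1 - V2) \<union> (V2 - V1)"
  define g where "g v = (if v \<in> V1 then g1 v else g2 v)" for v
  have g: "g v \<in> N" "v \<in> ends (g v)" if "v \<in> W" for v
    using that g1[of v] g2[of v] by (auto simp: W_def g_def N_def)
  \<comment> \<open>The vertices of \<open>X\<close> are met from one side only, yet their chosen
    ends are linked and so not free. Their signs cancel in pairs, so the free ends in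
    \<open>T\<close> have the same sum as all of \<open>W\<close>.\<close>
  define X where "X = p ` \<C>0 \<union> q ` \<C>0"
  define T where "T = (\<lambda>v. (g v, v)) ` (W - X)"
  define H where "H = Sigma N ends"
  define \<chi> where "\<chi> x = (if x \<in> N1 then 1 else -1 :: int)" for x
  have "\<exists>\<chi>' :: 'e \<Rightarrow> int. (\<forall>x\<in>N. \<chi>' x \<in> {1, -1}) \<and> (\<forall>(h, h')\<in>L. \<chi>' (fst h') = - \<chi>' (fst h)) \<and>
    (let e' = \<Sum>x\<in>N. \<chi>' x; t' = \<Sum>h\<in>T. \<chi>' (fst h)
      in \<bar>e'\<bar> \<le> 1 \<and> \<bar>t'\<bar> \<le> 2 \<and> \<bar>t' - e'\<bar> \<le> 2)"
  proof (rule exists_balanced_linked_signs)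
    show "finite N" "finite H" using finN fin_ends by (auto simp: H_def)
    show "fst ` H \<subseteq> N" by (auto simp: H_def)
    show "card {h \<in> H. fst h = x} = 2" if "x \<in> N" for x
    proof -
      have "{h \<in> H. fst h = x} = Pair x ` ends x" using that by (auto simp: H_def)
      then show ?thesis using two[of x] that by (simp add: card_image inj_on_def N_def)
    qed
    show "\<chi> x \<in> {1, -1}" for x by (simp add: \<chi>_def)
    show "L \<subseteq> H \<times> H" using QV g1 g2 by (auto simp: L_def H_def N_def)
    show "inj_on fst L" by (auto simp: inj_on_def L_def) (metis Q1)+
    show "inj_on snd L" by (auto simp: inj_on_def L_def) (metis Q2)+
    show "\<chi> (fst h) = 1 \<and> \<chi> (fst h') = -1" if "(h, h') \<in> L" for h h'
      using that QV g1 g2 disj by (auto simp: L_def \<chi>_def)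
    show "T \<subseteq> H - fst ` L - snd ` L"
    proof -
      have "v \<in> X" if "v \<in> W" "v \<in> fst ` Q \<or> v \<in> snd ` Q" for v
        using that by (auto simp: X_def Q_def W_def)
      then show ?thesis using g by (force simp: T_def H_def L_def)
    qed
  qed
  then obtain \<chi>' :: "'e \<Rightarrow> int" where \<chi>': "\<And>x. x \<in> N \<Longrightarrow> \<chi>' x \<in> {1, -1}"
    and link: "\<And>h h'. (h, h') \<in> L \<Longrightarrow> \<chi>' (fst h') = - \<chi>' (fst h)"
    and bal: "\<bar>\<Sum>x\<in>N. \<chi>' x\<bar> \<le> 1" "\<bar>\<Sum>h\<in>T. \<chi>' (fst h)\<bar> \<le> 2" "\<bar>(\<Sum>h\<in>T. \<chi>' (fst h)) - (\<Sum>x\<in>N. \<chi>' x)\<bar> \<le> 2"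
    unfolding Let_def by blast
  have linkQ: "\<chi>' (g2 w) = - \<chi>' (g1 v)" if "(v, w) \<in> Q" for v w
    using link[of "(g1 v, v)" "(g2 w, w)"] that by (force simp: L_def)
  define M where "M s = {x \<in> N. \<chi>' x = s}" for s
  \<comment> \<open>A vertex of \<open>W\<close> is a root only of the part that receives its chosen
    edge \<open>g v\<close>, even if the other part meets it too. This makes the root difference a
    sum of signs.\<close>
  define R where "R s = (V1 \<inter> V2) \<union> {v \<in> W. \<chi>' (g v) = s}" for s
  have "(\<Sum>v\<in>X. \<chi>' (g v)) = (\<Sum>C\<in>\<C>0. \<chi>' (g1 (p C))) + (\<Sum>C\<in>\<C>0. \<chi>' (g2 (q C)))"
  proof -
    have "p C \<noteq> q C'" if "C \<in> \<C>0" "C' \<in> \<C>0" for C C'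
      using p0(2)[OF that(1)] q0(2)[OF that(2)] by metis
    then have "p ` \<C>0 \<inter> q ` \<C>0 = {}" by auto
    then have "(\<Sum>v\<in>X. \<chi>' (g v)) = (\<Sum>v\<in>p ` \<C>0. \<chi>' (g v)) + (\<Sum>v\<in>q ` \<C>0. \<chi>' (g v))"
      unfolding X_def using fin\<C>0 by (intro sum.union_disjoint) auto
    also have "\<dots> = (\<Sum>C\<in>\<C>0. \<chi>' (g1 (p C))) + (\<Sum>C\<in>\<C>0. \<chi>' (g2 (q C)))"
      using p0 q0 by (auto simp: sum.reindex[OF injp] sum.reindex[OF injq] g_def intro!: arg_cong2[of _ _ _ _ "(+)"] sum.cong)
    finally show ?thesis .
  qed
  also have "\<dots> = 0"
  proof -
    have "\<chi>' (g2 (q C)) = - \<chi>' (g1 (p C))" if "C \<in> \<C>0" for C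
      using that by (intro linkQ) (simp add: Q_def)
    then show ?thesis by (simp add: sum_negf)
  qed
  finally have sumX: "(\<Sum>v\<in>X. \<chi>' (g v)) = 0" .
  have finW: "finite W" using finV by (simp add: W_def)
  have XW: "X \<subseteq> W" using p0 q0 by (auto simp: X_def W_def)
  have "(\<Sum>v\<in>W. \<chi>' (g v)) = (\<Sum>v\<in>W - X. \<chi>' (g v))"
    using sum.subset_diff[OF XW finW, of "\<lambda>v. \<chi>' (g v)"] sumX by simp
  also have "\<dots> = (\<Sum>h\<in>T. \<chi>' (fst h))"
    unfolding T_def by (subst sum.reindex) (auto simp: inj_on_def)
  finally have t: "(\<Sum>v\<in>W. \<chi>' (g v)) = (\<Sum>h\<in>T. \<chi>' (fst h))" .
  have \<chi>W: "\<chi>' (g v) \<in> {1, -1}" if "v \<in> W" for v using \<chi>' g(1)[OF that] by blast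
  have "card (R s) = card (V1 \<inter> V2) + card {v \<in> W. \<chi>' (g v) = s}" for s
    unfolding R_def using finV finW by (intro card_Un_disjoint) (auto simp: W_def)
  then have cR: "int (card (R 1)) - int (card (R (-1))) = (\<Sum>h\<in>T. \<chi>' (fst h))"
    using sum_signs[OF finW \<chi>W] t by simp
  have cM: "int (card (M 1)) - int (card (M (-1))) = (\<Sum>x\<in>N. \<chi>' x)"
    using sum_signs[OF finN \<chi>'] by (simp add: M_def)
  have RM: "R s \<subseteq> \<Union>(ends ` M s)" if "s \<in> {1, -1}" for s
  proof
    fix v assume v: "v \<in> R s"
    show "v \<in> \<Union>(ends ` M s)"
    proof (cases "v \<in> W")
      case True
      with v g[of v] show ?thesis by (auto simp: R_def M_def W_def)
    next
      case False
      with v have v12: "v \<in> V1" "v \<in> V2" by (auto simp: R_def)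
      then have "\<chi>' (g2 v) = - \<chi>' (g1 v)" by (intro linkQ) (simp add: Q_def)
      moreover have "g1 v \<in> N" "g2 v \<in> N" using g1 g2 v12 by (auto simp: N_def)
      ultimately have "g1 v \<in> M s \<or> g2 v \<in> M s" using \<chi>'[of "g1 v"] that by (auto simp: M_def)
      then show ?thesis using g1 g2 v12 by blast
    qed
  qed
  have RC: "C \<inter> R s \<noteq> {}" if "C \<in> \<C>" "s \<in> {1, -1}" for C s
  proof (cases "C \<inter> V1 \<inter> V2 = {}")
    case False
    then show ?thesis by (auto simp: R_def)
  next
    case True
    with that(1) have C: "C \<in> \<C>0" by (simp add: \<C>0_def)
    then have "\<chi>' (g2 (q C)) = - \<chi>' (g1 (p C))" by (intro linkQ) (simp add: Q_def)
    then have "\<chi>' (g (q C)) = - \<chi>' (g (p C))" using p0[OF C] q0[OF C] by (simp add: g_def)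
    moreover have W: "p C \<in> W" "q C \<in> W" using p0[OF C] q0[OF C] by (simp_all add: W_def)
    ultimately have "\<chi>' (g (p C)) = s \<or> \<chi>' (g (q C)) = s" using \<chi>W[of "p C"] that(2) by auto
    then have "p C \<in> R s \<or> q C \<in> R s" using W by (auto simp: R_def)
    then show ?thesis using p0(1)[OF C] q0(1)[OF C] by blast
  qed
  show ?thesis
  proof (intro exI conjI ballI)
    show "M 1 \<union> M (-1) = N1 \<union> N2" using \<chi>' by (auto simp: M_def N_def)
    show "M 1 \<inter> M (-1) = {}" by (auto simp: M_def)
    show "R 1 \<union> R (-1) = \<Union>(ends ` N1) \<union> \<Union>(ends ` N2)"
      using \<chi>W unfolding V1_def[symmetric] V2_def[symmetric] by (auto simp: R_def W_def)
  qed (use RM RC cM cR bal in auto)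
qed

section \<open>Cuts and spanning arc sets\<close>

context fin_digraph
begin

definition entering :: "'b set \<Rightarrow> 'a set \<Rightarrow> 'b set" where
  "entering A U = {a \<in> A. head G a \<in> U \<and> tail G a \<notin> U}"

text \<open>Reachability of all vertices from \<open>R\<close> along arcs of \<open>A\<close>,
  stated by cuts so that submodularity applies; \<open>spans_iff_reachable\<close> gives the path
  form.\<close>

definition spans :: "'b set \<Rightarrow> 'a set \<Rightarrow> bool" where
  "spans A R \<longleftrightarrow> (\<forall>U\<subseteq>verts G. U \<noteq> {} \<and> U \<inter> R = {} \<longrightarrow> entering A U \<noteq> {})"

lemma finite_entering: "A \<subseteq> arcs G \<Longrightarrow> finite (entering A U)"
  unfolding entering_def by (auto intro: finite_subset[OF _ finite_arcs])

text \<open>An arc entering the intersection or the union enters \<open>X\<close> or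
  \<open>Y\<close>, and an arc entering both of them enters both \<open>X\<close> and
  \<open>Y\<close>.\<close>

lemma card_entering_submodular:
  assumes "A \<subseteq> arcs G"
  shows "card (entering A (X \<inter> Y)) + card (entering A (X \<union> Y))
    \<le> card (entering A X) + card (entering A Y)"
proof -
  note fin = finite_entering[OF assms]
  have "card (entering A (X \<inter> Y)) + card (entering A (X \<union> Y))
    = card (entering A (X \<inter> Y) \<union> entering A (X \<union> Y)) + card (entering A (X \<inter> Y) \<inter> entering A (X \<union> Y))"
    by (rule card_Un_Int[OF fin fin])
  also have "\<dots> \<le> card (entering A X \<union> entering A Y) + card (entering A X \<inter> entering A Y)"
    using fin by (intro add_mono card_mono) (auto simp: entering_def)
  also have "\<dots> = card (entering A X) + card (entering A Y)"
    by (rule card_Un_Int[OF fin fin, symmetric])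
  finally show ?thesis .
qed

lemma entering_mono: "A \<subseteq> B \<Longrightarrow> entering A U \<subseteq> entering B U"
  by (auto simp: entering_def)

lemma spans_mono:
  assumes "spans A R" "A \<subseteq> B" "R \<subseteq> S"
  shows "spans B S"
  unfolding spans_def
proof (intro allI impI)
  fix U assume "U \<subseteq> verts G" "U \<noteq> {} \<and> U \<inter> S = {}"
  moreover from this have "U \<inter> R = {}" using assms(3) by blast
  ultimately have "entering A U \<noteq> {}" using assms(1) by (simp add: spans_def)
  with entering_mono[OF assms(2)] show "entering B U \<noteq> {}" by blast
qed

text \<open>A set avoiding \<open>R\<close> misses the tail of \<open>a\<close>: it is entered by
  \<open>a\<close> if it contains the head, and otherwise avoids the enlarged root set as well.
  Branchings are grown by this step.\<close>

lemma spans_insert_arc: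
  assumes "tail G a \<in> R" and "spans A (insert (head G a) R)"
  shows "spans (insert a A) R"
  unfolding spans_def
proof (intro allI impI)
  fix U assume U: "U \<subseteq> verts G" "U \<noteq> {} \<and> U \<inter> R = {}"
  show "entering (insert a A) U \<noteq> {}"
  proof (cases "head G a \<in> U")
    case True
    with U assms(1) have "a \<in> entering (insert a A) U"
      by (auto simp: entering_def)
    then show ?thesis by blast
  next
    case False
    with U assms(2) have "entering A U \<noteq> {}" by (simp add: spans_def)
    then show ?thesis by (auto simp: entering_def)
  qed
qed

text \<open>A branching grown from \<open>R\<close> spends one arc on each newly reached
  vertex.\<close>

lemma spans_subset_card:
  assumes "spans A R" "A \<subseteq> arcs G" "R \<subseteq> verts G"
  shows "\<exists>B\<subseteq>A. card B \<le> card (verts G - R) \<and> spans B R"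
  using assms(1,3)
proof (induction "card (verts G - R)" arbitrary: R)
  case 0
  then have "verts G \<subseteq> R" by simp
  then have "spans {} R" by (auto simp: spans_def)
  then show ?case by (intro exI[of _ "{}"]) auto
next
  case (Suc n)
  then have "verts G - R \<noteq> {}" by auto
  with Suc.prems(1) have "entering A (verts G - R) \<noteq> {}" by (auto simp: spans_def)
  then obtain a where a: "a \<in> A" "head G a \<in> verts G - R" "tail G a \<in> R"
    using assms(2) by (auto simp: entering_def)
  have "verts G - insert (head G a) R = (verts G - R) - {head G a}" by auto
  then have c: "card (verts G - insert (head G a) R) = n"
    using a Suc.hyps(2) by simp
  obtain B where B: "B \<subseteq> A" "card B \<le> n" "spans B (insert (head G a) R)"
    using Suc.hyps(1)[OF c[symmetric] spans_mono[OF Suc.prems(1)]] Suc.prems(2) a c by auto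
  have "spans (insert a B) R"
    using a B by (intro spans_insert_arc)
  moreover have "card (insert a B) \<le> Suc n"
    using B(2) card_insert_le_m1[of "Suc n" B a] by simp
  ultimately show ?case using a B Suc.hyps(2) by (intro exI[of _ "insert a B"]) auto
qed

section \<open>Two disjoint branchings and their sizes\<close>

text \<open>Lovasz' argument for Edmonds' disjoint branching theorem: if some tight set is not yet reached
  by the first branching, then an arc inside an inclusion-minimal one can be added to it.\<close>

lemma disjoint_spanning_pair:
  assumes "A \<subseteq> arcs G" "R \<subseteq> verts G"
    and "\<And>U. U \<subseteq> verts G \<Longrightarrow> U \<noteq> {} \<Longrightarrow>
      of_bool (U \<inter> R = {}) + of_bool (U \<inter> S = {}) \<le> card (entering A U)"
  shows "\<exists>B\<subseteq>A. spans B R \<and> spans (A - B) S"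
  using assms
proof (induction "card (verts G - R)" arbitrary: A R)
  case 0
  then have R: "verts G \<subseteq> R" by simp
  then have "spans {} R" by (auto simp: spans_def)
  moreover have "spans A S"
    unfolding spans_def
  proof (intro allI impI)
    fix U assume "U \<subseteq> verts G" "U \<noteq> {} \<and> U \<inter> S = {}"
    with "0.prems"(3)[of U] show "entering A U \<noteq> {}" by auto
  qed
  ultimately show ?case by (intro exI[of _ "{}"]) auto
next
  case (Suc n)
  note cut = Suc.prems(3)
  note fin = finite_entering[OF Suc.prems(1)]
  \<comment> \<open>The only arc entering a tight set is still needed for \<open>S\<close>, so the
    next arc of the branching from \<open>R\<close> must not be that one. Sets inside
    \<open>R\<close> are harmless, because the next arc has its head outside
    \<open>R\<close>.\<close>
  define tight where "tight U \<longleftrightarrow> U \<subseteq> verts G \<and> U \<inter> S = {} \<and> \<not> U \<subseteq> R \<and> card (entering A U) = 1" for U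
  have "\<exists>a\<in>A. tail G a \<in> R \<and> head G a \<in> verts G - R \<and> (\<forall>T. tight T \<longrightarrow> a \<notin> entering A T)"
  proof (cases "\<exists>U. tight U")
    case False
    have "verts G - R \<noteq> {}" using Suc.hyps(2) by (metis card.empty nat.distinct(1))
    with cut[of "verts G - R"] have "card (entering A (verts G - R)) \<noteq> 0"
      by (auto simp: Int_Diff)
    then obtain a where "a \<in> entering A (verts G - R)" by fastforce
    with Suc.prems(1) False show ?thesis by (auto simp: entering_def)
  next
    case True
    then obtain U where U: "tight U" and min: "\<And>T. tight T \<Longrightarrow> card U \<le> card T"
      using ex_has_least_nat[of tight _ card] by blast
    have finU: "finite U" using U finite_subset[OF _ finite_verts] by (auto simp: tight_def)
    \<comment> \<open>\<open>U - R\<close> avoids both root sets, so two arcs enter it, while only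
      one enters \<open>U\<close>. Hence some arc leads from \<open>U \<inter> R\<close> to
      \<open>U - R\<close>.\<close>
    have "2 \<le> card (entering A (U - R))"
    proof -
      have "(U - R) \<inter> R = {}" "(U - R) \<inter> S = {}" "U - R \<subseteq> verts G" "U - R \<noteq> {}"
        using U by (auto simp: tight_def)
      with cut[of "U - R"] show ?thesis by simp
    qed
    then have "\<not> entering A (U - R) \<subseteq> entering A U"
      using card_mono[OF fin, of "entering A (U - R)" U] U by (auto simp: tight_def)
    then obtain a where a: "a \<in> A" "head G a \<in> U - R" "tail G a \<in> U" "tail G a \<in> R"
      by (auto simp: entering_def)
    have "a \<notin> entering A T" if T: "tight T" for T
    proof
      assume "a \<in> entering A T"
      then have aT: "head G a \<in> T" "tail G a \<notin> T" by (auto simp: entering_def)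
      \<comment> \<open>Uncrossing: each of these cuts needs an arc for \<open>S\<close>, and
        submodularity allows only two in total. So \<open>T \<inter> U\<close> is tight, but it
        lacks the tail of \<open>a\<close>, against the minimality of \<open>U\<close>.\<close>
      have "1 \<le> card (entering A (T \<inter> U))" "1 \<le> card (entering A (T \<union> U))"
      proof -
        have "(T \<inter> U) \<inter> S = {}" "(T \<union> U) \<inter> S = {}" "T \<inter> U \<subseteq> verts G" "T \<union> U \<subseteq> verts G"
          "T \<inter> U \<noteq> {}" "T \<union> U \<noteq> {}"
          using T U aT a by (auto simp: tight_def)
        with cut[of "T \<inter> U"] cut[of "T \<union> U"]
        show "1 \<le> card (entering A (T \<inter> U))" "1 \<le> card (entering A (T \<union> U))"
          by simp_all
      qed
      moreover have "card (entering A (T \<inter> U)) + card (entering A (T \<union> U)) \<le> 2"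
        using card_entering_submodular[OF Suc.prems(1), of T U] T U by (simp add: tight_def)
      ultimately have "tight (T \<inter> U)" using T U aT a by (auto simp: tight_def)
      then have "card U \<le> card (T \<inter> U)" by (rule min)
      moreover have "card (T \<inter> U) < card U"
        by (rule psubset_card_mono[OF finU]) (use a aT in blast)
      ultimately show False by simp
    qed
    moreover have "head G a \<in> verts G" using a U by (auto simp: tight_def)
    ultimately show ?thesis using a by blast
  qed
  then obtain a where a: "a \<in> A" "tail G a \<in> R" "head G a \<in> verts G" "head G a \<notin> R"
    and free: "\<And>T. tight T \<Longrightarrow> a \<notin> entering A T" by auto
  let ?R = "insert (head G a) R"
  have "verts G - ?R = (verts G - R) - {head G a}" by auto
  then have c: "n = card (verts G - ?R)"
    using a Suc.hyps(2) by simp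
  have "\<exists>B\<subseteq>A - {a}. spans B ?R \<and> spans (A - {a} - B) S"
  proof (rule Suc.hyps(1)[OF c])
    fix U assume U: "U \<subseteq> verts G" "U \<noteq> {}"
    have e: "entering (A - {a}) U = entering A U - {a}" by (auto simp: entering_def)
    show "of_bool (U \<inter> ?R = {}) + of_bool (U \<inter> S = {}) \<le> card (entering (A - {a}) U)"
    proof (cases "a \<in> entering A U")
      case False
      then have "card (entering (A - {a}) U) = card (entering A U)" using e by simp
      moreover have "of_bool (U \<inter> ?R = {}) \<le> (of_bool (U \<inter> R = {}) :: nat)"
        by (auto simp: of_bool_def)
      ultimately show ?thesis using cut[OF U] by linarith
    next
      case True
      then have "head G a \<in> U" by (simp add: entering_def)
      have "\<not> tight U" using free True by blast
      moreover have "card (entering A U) \<noteq> 0" using True fin[of U] by auto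
      ultimately have "of_bool (U \<inter> S = {}) \<le> card (entering A U) - 1"
        using U a \<open>head G a \<in> U\<close> by (auto simp: tight_def)
      with True e fin[of U] \<open>head G a \<in> U\<close> show ?thesis by simp
    qed
  qed (use Suc.prems a in auto)
  then obtain B where B: "B \<subseteq> A - {a}" "spans B ?R" "spans (A - {a} - B) S" by blast
  show ?case
  proof (intro exI conjI)
    show "insert a B \<subseteq> A" using a B by auto
    show "spans (insert a B) R" by (rule spans_insert_arc) (use a B in auto)
    show "spans (A - insert a B) S" using B(3) unfolding Diff_insert2[of A a B] .
  qed
qed

text \<open>Singletons outside \<open>R\<close> are cuts, so every such vertex is the head of an arc
  of its own.\<close>

lemma card_le_if_spans:
  assumes "spans A R" "A \<subseteq> arcs G"
  shows "card (verts G - R) \<le> card A"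
proof -
  have fin: "finite A" using assms(2) by (rule finite_subset) (rule finite_arcs)
  have "v \<in> head G ` A" if "v \<in> verts G - R" for v
  proof -
    have "entering A {v} \<noteq> {}" using assms(1) that by (auto simp: spans_def)
    then show ?thesis by (auto simp: entering_def)
  qed
  then have "card (verts G - R) \<le> card (head G ` A)"
    using fin by (intro card_mono) auto
  also have "\<dots> \<le> card A" by (rule card_image_le[OF fin])
  finally show ?thesis .
qed

text \<open>Both spanning sets can be trimmed to branchings \<open>X\<close> and \<open>Y\<close> of
  the least possible size. Additional arcs never hurt, so the remaining ones can be divided at will,
  and every size \<open>b\<close> within the two bounds occurs.\<close>

lemma disjoint_spanning_pair_card:
  assumes A: "A \<subseteq> arcs G" and RS: "R \<subseteq> verts G" "S \<subseteq> verts G"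
    and cut: "\<And>U. U \<subseteq> verts G \<Longrightarrow> U \<noteq> {} \<Longrightarrow>
      of_bool (U \<inter> R = {}) + of_bool (U \<inter> S = {}) \<le> card (entering A U)"
  shows "card (verts G - R) + card (verts G - S) \<le> card A"
    and "card (verts G - R) \<le> b \<Longrightarrow> b + card (verts G - S) \<le> card A \<Longrightarrow>
      \<exists>B\<subseteq>A. card B = b \<and> spans B R \<and> spans (A - B) S"
proof -
  have fin: "finite A" using A by (rule finite_subset) (rule finite_arcs)
  obtain B where B: "B \<subseteq> A" "spans B R" "spans (A - B) S"
    using disjoint_spanning_pair[OF A RS(1) cut] by blast
  have "card (verts G - R) \<le> card B" "card (verts G - S) \<le> card (A - B)"
    using B A by (auto intro!: card_le_if_spans)
  moreover have "card B + card (A - B) = card A"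
    using B(1) fin by (metis card_Diff_subset card_mono finite_subset le_add_diff_inverse)
  ultimately show "card (verts G - R) + card (verts G - S) \<le> card A" by linarith
  assume b: "card (verts G - R) \<le> b" "b + card (verts G - S) \<le> card A"
  obtain X where X: "X \<subseteq> B" "card X \<le> card (verts G - R)" "spans X R"
    using spans_subset_card[OF B(2)] B(1) A RS by auto
  obtain Y where Y: "Y \<subseteq> A - B" "card Y \<le> card (verts G - S)" "spans Y S"
    using spans_subset_card[OF B(3)] A RS by auto
  have "card (A - Y) = card A - card Y"
    using Y(1) fin by (intro card_Diff_subset) (auto intro: finite_subset)
  with b X Y have "card X \<le> b" "b \<le> card (A - Y)" "X \<subseteq> A - Y"
    using B(1) by auto
  then obtain Z where Z: "X \<subseteq> Z" "Z \<subseteq> A - Y" "card Z = b"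
    using exists_subset_between[of X b "A - Y"] fin by auto
  have "spans Z R" by (rule spans_mono[OF X(3) Z(1)]) simp
  moreover have "spans (A - Z) S" by (rule spans_mono[OF Y(3)]) (use Y(1) Z(2) in auto)
  ultimately show "\<exists>B\<subseteq>A. card B = b \<and> spans B R \<and> spans (A - B) S"
    using Z by blast
qed

text \<open>For a set \<open>A\<close> of arcs of \<open>G\<close>, these are the strongly connected
  components that no arc of \<open>A\<close> enters, described as minimal cuts.\<close>

definition sources :: "'b set \<Rightarrow> 'a set set" where
  "sources A = {U. U \<subseteq> verts G \<and> U \<noteq> {} \<and> entering A U = {} \<and>
    (\<forall>W. W \<subset> U \<longrightarrow> W \<noteq> {} \<longrightarrow> entering A W \<noteq> {})}"

text \<open>The intersection of two sets that no arc enters is again such a set, so minimality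
  forbids it to be nonempty and smaller than either.\<close>

lemma disjoint_sources:
  assumes "C \<in> sources A" "C' \<in> sources A" "C \<noteq> C'"
  shows "C \<inter> C' = {}"
proof (rule ccontr)
  assume ne: "C \<inter> C' \<noteq> {}"
  have "entering A (C \<inter> C') = {}"
    using assms(1,2) by (auto simp: sources_def entering_def)
  have "\<not> C \<inter> C' \<subset> D" if "D \<in> sources A" for D
  proof
    assume "C \<inter> C' \<subset> D"
    with that ne have "entering A (C \<inter> C') \<noteq> {}" by (simp add: sources_def)
    with \<open>entering A (C \<inter> C') = {}\<close> show False by simp
  qed
  from this[OF assms(1)] this[OF assms(2)] assms(3) show False by auto
qed

lemma source_subset:
  assumes "U \<subseteq> verts G" "U \<noteq> {}" "entering A U = {}"
  shows "\<exists>C\<in>sources A. C \<subseteq> U"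
proof -
  let ?P = "\<lambda>W. W \<subseteq> U \<and> W \<noteq> {} \<and> entering A W = {}"
  obtain C where C: "?P C" and min: "\<And>W. ?P W \<Longrightarrow> card C \<le> card W"
    using assms ex_has_least_nat[of ?P U card] by blast
  have "finite C" using C assms(1) finite_subset[OF _ finite_verts] by blast
  then have "entering A W \<noteq> {}" if "W \<subset> C" "W \<noteq> {}" for W
    using min[of W] psubset_card_mono[OF _ that(1)] that C by force
  with C assms(1) have "C \<in> sources A" by (auto simp: sources_def)
  with C show ?thesis by blast
qed

lemma source_meets:
  assumes "C \<in> sources (A \<union> B)" "spans A R"
  shows "C \<inter> R \<noteq> {}"
  using assms by (auto simp: sources_def spans_def entering_def)

text \<open>A cut entered by exactly one arc of \<open>A \<union> B\<close> meets \<open>R \<union> S\<close>, so only the cuts entered by no arc,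
  and among those the minimal ones, constrain how \<open>R \<union> S\<close> may be distributed anew.\<close>

lemma cut_condition_redistribute:
  assumes "A \<subseteq> arcs G" "B \<subseteq> arcs G" "A \<inter> B = {}" "spans A R" "spans B S"
    and un: "R' \<union> S' = R \<union> S"
    and src: "\<And>C. C \<in> sources (A \<union> B) \<Longrightarrow> C \<inter> R' \<noteq> {} \<and> C \<inter> S' \<noteq> {}"
    and U: "U \<subseteq> verts G" "U \<noteq> {}"
  shows "of_bool (U \<inter> R' = {}) + of_bool (U \<inter> S' = {}) \<le> card (entering (A \<union> B) U)"
proof -
  have e: "entering (A \<union> B) U = entering A U \<union> entering B U" by (auto simp: entering_def)
  have fin: "finite (entering A U)" "finite (entering B U)"
    using assms by (auto intro: finite_entering)
  have c: "card (entering (A \<union> B) U) = card (entering A U) + card (entering B U)"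
    unfolding e using fin assms(3) by (intro card_Un_disjoint) (auto simp: entering_def)
  have "card (entering A U) \<noteq> 0" if "U \<inter> R = {}"
    using assms(4) U that fin by (auto simp: spans_def)
  moreover have "card (entering B U) \<noteq> 0" if "U \<inter> S = {}"
    using assms(5) U that fin by (auto simp: spans_def)
  moreover have "U \<inter> R' \<noteq> {} \<and> U \<inter> S' \<noteq> {}" if "card (entering (A \<union> B) U) = 0"
  proof -
    have "entering (A \<union> B) U = {}" using that fin e by simp
    then obtain C where "C \<in> sources (A \<union> B)" "C \<subseteq> U" using source_subset[OF U] by blast
    with src show ?thesis by blast
  qed
  \<comment> \<open>The only demand for two arcs: a set avoiding both new root sets avoids both old
    ones, and is therefore entered by an arc of \<open>A\<close> and by an arc of
    \<open>B\<close>.\<close>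
  moreover have "U \<inter> R = {} \<and> U \<inter> S = {}" if "U \<inter> R' = {}" "U \<inter> S' = {}"
    using un that by blast
  ultimately show ?thesis using c by (auto split: if_splits simp: of_bool_def)
qed

end

section \<open>Exchanges between mixed edge covers\<close>

context fin_digraph
begin

text \<open>The unreached vertices form a cut that no arc enters; conversely, a walk that starts
  outside such a cut never gets into it.\<close>

lemma spans_iff_reachable:
  assumes "A \<subseteq> arcs G" "R \<subseteq> verts G"
  shows "spans A R \<longleftrightarrow> (\<forall>v\<in>verts G. \<exists>u\<in>R. u \<rightarrow>\<^sup>*\<^bsub>G\<lparr>arcs := A\<rparr>\<^esub> v)"
proof -
  interpret A: wf_digraph "G\<lparr>arcs := A\<rparr>"
    using assms(1) by unfold_locales auto
  show ?thesis
  proof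
    assume sp: "spans A R"
    define U where "U = {v \<in> verts G. \<not> (\<exists>u\<in>R. u \<rightarrow>\<^sup>*\<^bsub>G\<lparr>arcs := A\<rparr>\<^esub> v)}"
    have "U = {}"
    proof (rule ccontr)
      assume "U \<noteq> {}"
      moreover have "U \<inter> R = {}" using assms(2) by (auto simp: U_def)
      moreover have "U \<subseteq> verts G" by (auto simp: U_def)
      ultimately have "entering A U \<noteq> {}" using sp by (simp add: spans_def)
      then obtain a where a: "a \<in> A" "head G a \<in> U" "tail G a \<notin> U" by (auto simp: entering_def)
      then have "tail G a \<in> verts G" using assms(1) by auto
      with a obtain u where u: "u \<in> R" "u \<rightarrow>\<^sup>*\<^bsub>G\<lparr>arcs := A\<rparr>\<^esub> tail G a" by (auto simp: U_def)
      have "tail G a \<rightarrow>\<^bsub>G\<lparr>arcs := A\<rparr>\<^esub> head G a" using a(1) by (auto simp: arcs_ends_conv)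
      with u(2) have "u \<rightarrow>\<^sup>*\<^bsub>G\<lparr>arcs := A\<rparr>\<^esub> head G a" by (rule A.reachable_adj_trans)
      with u(1) a(2) show False by (auto simp: U_def)
    qed
    then show "\<forall>v\<in>verts G. \<exists>u\<in>R. u \<rightarrow>\<^sup>*\<^bsub>G\<lparr>arcs := A\<rparr>\<^esub> v" by (auto simp: U_def)
  next
    assume reach: "\<forall>v\<in>verts G. \<exists>u\<in>R. u \<rightarrow>\<^sup>*\<^bsub>G\<lparr>arcs := A\<rparr>\<^esub> v"
    show "spans A R"
      unfolding spans_def
    proof (intro allI impI notI)
      fix U assume U: "U \<subseteq> verts G" "U \<noteq> {} \<and> U \<inter> R = {}" "entering A U = {}"
      then obtain v where v: "v \<in> U" "v \<in> verts G" by blast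
      with reach obtain u where u: "u \<in> R" "u \<rightarrow>\<^sup>*\<^bsub>G\<lparr>arcs := A\<rparr>\<^esub> v" by blast
      from u(2) have "v \<notin> U"
      proof (induction rule: A.reachable_induct)
        case base
        then show ?case using u(1) U(2) by blast
      next
        case (step y z)
        then obtain a where "a \<in> A" "y = tail G a" "z = head G a" by (auto simp: arcs_ends_conv)
        with step U(3) show ?case by (auto simp: entering_def)
      qed
      with v show False by simp
    qed
  qed
qed

end

context mixed_graph
begin

lemma ends_image_subset: "M \<subseteq> E \<Longrightarrow> \<Union>(ends ` M) \<subseteq> verts D"
  using ends_in_verts by blast

lemma mixed_edge_cover_iff_spans:
  "mixed_edge_cover D E ends F \<longleftrightarrow>
    F \<subseteq> E \<union> arcs D \<and> spans (F \<inter> arcs D) (\<Union>(ends ` (F \<inter> E)))"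
proof -
  interpret F: wf_digraph "D\<lparr>arcs := F \<inter> arcs D\<rparr>"
    by unfold_locales auto
  show ?thesis
    unfolding mixed_edge_cover_def
    by (subst spans_iff_reachable) (auto simp: F.reachable_apath ends_image_subset)
qed

lemma card_eq_edges_plus_arcs:
  assumes "F \<subseteq> E \<union> arcs D"
  shows "card F = card (F \<inter> E) + card (F \<inter> arcs D)"
proof -
  have "F = (F \<inter> E) \<union> (F \<inter> arcs D)" using assms by blast
  then show ?thesis
    using finite_edges edges_arcs_disjoint card_Un_disjoint[of "F \<inter> E" "F \<inter> arcs D"] by auto
qed

lemma balanced_pair:
  assumes "mixed_edge_cover D E ends F1" "mixed_edge_cover D E ends F2" "F1 \<inter> F2 = {}"
  shows "\<exists>F1' F2'. mixed_edge_cover D E ends F1' \<and> mixed_edge_cover D E ends F2' \<and>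
    F1' \<inter> F2' = {} \<and> F1' \<union> F2' = F1 \<union> F2 \<and>
    \<bar>int (card (F1' \<inter> E)) - int (card (F2' \<inter> E))\<bar> \<le> 1 \<and>
    \<bar>int (card (F1' \<inter> arcs D)) - int (card (F2' \<inter> arcs D))\<bar> \<le> 2 \<and>
    \<bar>int (card F1') - int (card F2')\<bar> \<le> 2"
proof -
  let ?N1 = "F1 \<inter> E" and ?N2 = "F2 \<inter> E" and ?B1 = "F1 \<inter> arcs D" and ?B2 = "F2 \<inter> arcs D"
  let ?A = "?B1 \<union> ?B2"
  have F: "F1 \<subseteq> E \<union> arcs D" "F2 \<subseteq> E \<union> arcs D"
    and sp: "spans ?B1 (\<Union>(ends ` ?N1))" "spans ?B2 (\<Union>(ends ` ?N2))"
    using assms(1,2) by (simp_all add: mixed_edge_cover_iff_spans)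
  obtain M1 M2 R1 R2 where M: "M1 \<union> M2 = ?N1 \<union> ?N2" "M1 \<inter> M2 = {}"
    and RM: "R1 \<subseteq> \<Union>(ends ` M1)" "R2 \<subseteq> \<Union>(ends ` M2)"
    and R: "R1 \<union> R2 = \<Union>(ends ` ?N1) \<union> \<Union>(ends ` ?N2)"
    and src: "\<forall>C\<in>sources ?A. C \<inter> R1 \<noteq> {} \<and> C \<inter> R2 \<noteq> {}"
    and bal: "\<bar>int (card M1) - int (card M2)\<bar> \<le> 1" "\<bar>int (card R1) - int (card R2)\<bar> \<le> 2"
      "\<bar>(int (card R1) - int (card R2)) - (int (card M1) - int (card M2))\<bar> \<le> 2"
  proof -
    have "\<exists>M1 M2 R1 R2. M1 \<union> M2 = ?N1 \<union> ?N2 \<and> M1 \<inter> M2 = {} \<and>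
      R1 \<subseteq> \<Union>(ends ` M1) \<and> R2 \<subseteq> \<Union>(ends ` M2) \<and> R1 \<union> R2 = \<Union>(ends ` ?N1) \<union> \<Union>(ends ` ?N2) \<and>
      (\<forall>C\<in>sources ?A. C \<inter> R1 \<noteq> {} \<and> C \<inter> R2 \<noteq> {}) \<and>
      \<bar>int (card M1) - int (card M2)\<bar> \<le> 1 \<and> \<bar>int (card R1) - int (card R2)\<bar> \<le> 2 \<and>
      \<bar>(int (card R1) - int (card R2)) - (int (card M1) - int (card M2))\<bar> \<le> 2"
    proof (rule exists_balanced_roots)
      show "finite ?N1" "finite ?N2" using finite_edges by auto
      show "?N1 \<inter> ?N2 = {}" using assms(3) by blast
      show "card (ends x) = 2" if "x \<in> ?N1 \<union> ?N2" for x using that no_edge_loops by blast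
      show "C \<inter> C' = {}" if "C \<in> sources ?A" "C' \<in> sources ?A" "C \<noteq> C'" for C C'
        using that by (rule disjoint_sources)
      show "C \<inter> \<Union>(ends ` ?N1) \<noteq> {} \<and> C \<inter> \<Union>(ends ` ?N2) \<noteq> {}" if "C \<in> sources ?A" for C
      proof
        show "C \<inter> \<Union>(ends ` ?N1) \<noteq> {}" by (rule source_meets[OF that sp(1)])
        show "C \<inter> \<Union>(ends ` ?N2) \<noteq> {}"
          by (rule source_meets[OF _ sp(2), of _ ?B1]) (use that in \<open>simp only: Un_commute\<close>)
      qed
    qed
    then show thesis by (elim exE conjE) (rule that)
  qed
  have ME: "M1 \<subseteq> E" "M2 \<subseteq> E" using M(1) by auto
  have RV: "R1 \<subseteq> verts D" "R2 \<subseteq> verts D" using RM ends_image_subset ME by blast+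
  have A: "?A \<subseteq> arcs D" by blast
  have cut: "of_bool (U \<inter> R1 = {}) + of_bool (U \<inter> R2 = {}) \<le> card (entering ?A U)"
    if "U \<subseteq> verts D" "U \<noteq> {}" for U
    by (rule cut_condition_redistribute[OF _ _ _ sp R bspec[OF src] that]) (use assms(3) in auto)
  define m1 m2 n where "m1 = card (verts D - R1)" and "m2 = card (verts D - R2)" and "n = card ?A"
  have mn: "m1 + m2 \<le> n"
    unfolding m1_def m2_def n_def by (rule disjoint_spanning_pair_card(1)[OF A RV cut])
  have "int m1 = int (card (verts D)) - int (card R1)" "int m2 = int (card (verts D)) - int (card R2)"
    unfolding m1_def m2_def using RV card_mono[OF finite_verts]
    by (auto simp: card_Diff_subset finite_subset[OF _ finite_verts] of_nat_diff)
  then have t: "int m2 - int m1 = int (card R1) - int (card R2)" by linarith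
  have "\<exists>b. m1 \<le> b \<and> b + m2 \<le> n \<and> \<bar>2 * int b - int n\<bar> \<le> 2 \<and>
    \<bar>2 * int b - int n + (int (card M1) - int (card M2))\<bar> \<le> 2"
  proof (cases "m1 + m2 = n")
    case True
    then show ?thesis using bal t by (intro exI[of _ m1]) auto
  next
    case False
    \<comment> \<open>One spare arc and |m1 - m2| \<le> 2 make an equal split feasible, provided
      that for odd \<open>n\<close> the larger half goes to the part with more non-roots. The arc
      difference is then at most 1, which together with an edge difference of at most 1 keeps the
      total within 2.\<close>
    with mn bal t have "m1 \<le> (if m1 \<le> m2 then n div 2 else n - n div 2)"
      "(if m1 \<le> m2 then n div 2 else n - n div 2) + m2 \<le> n" by auto
    then show ?thesis using bal
      by (intro exI[of _ "if m1 \<le> m2 then n div 2 else n - n div 2"]) auto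
  qed
  then obtain b where b: "m1 \<le> b" "b + m2 \<le> n" "\<bar>2 * int b - int n\<bar> \<le> 2"
    "\<bar>2 * int b - int n + (int (card M1) - int (card M2))\<bar> \<le> 2" by blast
  obtain B where B: "B \<subseteq> ?A" "card B = b" "spans B R1" "spans (?A - B) R2"
    using disjoint_spanning_pair_card(2)[OF A RV cut, of b] b(1,2)
    unfolding m1_def m2_def n_def by blast
  define F1' F2' where "F1' = M1 \<union> B" and "F2' = M2 \<union> (?A - B)"
  have parts: "F1' \<inter> E = M1" "F1' \<inter> arcs D = B" "F2' \<inter> E = M2" "F2' \<inter> arcs D = ?A - B"
    using ME B(1) edges_arcs_disjoint by (auto simp: F1'_def F2'_def)
  have F': "F1' \<subseteq> E \<union> arcs D" "F2' \<subseteq> E \<union> arcs D" using ME B(1) by (auto simp: F1'_def F2'_def)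
  have covers: "mixed_edge_cover D E ends F1'" "mixed_edge_cover D E ends F2'"
    unfolding mixed_edge_cover_iff_spans parts using F' B(3,4) RM by (auto intro: spans_mono)
  have "card (?A - B) = n - b" "b \<le> n"
    using B(1,2) finite_subset[OF A finite_arcs] unfolding n_def
    by (auto simp: card_Diff_subset card_mono finite_subset)
  then have cards: "int (card B) - int (card (?A - B)) = 2 * int b - int n" using B(2) by simp
  have un: "F1' \<union> F2' = F1 \<union> F2"
  proof -
    have "F1' \<union> F2' = (M1 \<union> M2) \<union> ?A" using B(1) by (auto simp: F1'_def F2'_def)
    also have "\<dots> = F1 \<union> F2" unfolding M(1) using F by blast
    finally show ?thesis .
  qed
  have dis: "F1' \<inter> F2' = {}"
    using M(2) ME B(1) edges_arcs_disjoint by (auto simp: F1'_def F2'_def)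
  have "int (card F1') - int (card F2') = 2 * int b - int n + (int (card M1) - int (card M2))"
    unfolding card_eq_edges_plus_arcs[OF F'(1)] card_eq_edges_plus_arcs[OF F'(2)] parts
    using cards by simp
  with b have "\<bar>int (card F1') - int (card F2')\<bar> \<le> 2" by simp
  moreover have "\<bar>int (card (F1' \<inter> arcs D)) - int (card (F2' \<inter> arcs D))\<bar> \<le> 2"
    unfolding parts cards by (rule b(3))
  moreover have "\<bar>int (card (F1' \<inter> E)) - int (card (F2' \<inter> E))\<bar> \<le> 1"
    unfolding parts by (rule bal(1))
  ultimately show ?thesis using covers un dis by blast
qed

end

section \<open>From pairs to \<open>k\<close> parts by a quadratic potential\<close>

text \<open>The weight 3 suffices: a balanced pair contributes at most 8 on the differences, while
  \<open>\<bar>n\<bar> \<ge> 2\<close> alone contributes 12.\<close>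

lemma imbalance_less:
  fixes x1 x2 y1 y2 u1 u2 v1 v2 :: nat
  assumes sums: "x1 + x2 = u1 + u2" "y1 + y2 = v1 + v2"
    and new: "\<bar>int x1 - int x2\<bar> \<le> 1" "\<bar>int y1 - int y2\<bar> \<le> 2" "\<bar>int (x1 + y1) - int (x2 + y2)\<bar> \<le> 2"
    and old: "\<not> (\<bar>int u1 - int u2\<bar> \<le> 1 \<and> \<bar>int v1 - int v2\<bar> \<le> 2 \<and> \<bar>int (u1 + v1) - int (u2 + v2)\<bar> \<le> 2)"
  shows "(3 * x1^2 + y1^2 + (x1 + y1)^2) + (3 * x2^2 + y2^2 + (x2 + y2)^2)
    < (3 * u1^2 + v1^2 + (u1 + v1)^2) + (3 * u2^2 + v2^2 + (u2 + v2)^2)"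
proof -
  let ?\<Phi> = "\<lambda>n b :: int. 3 * n^2 + b^2 + (n + b)^2"
  \<comment> \<open>The parallelogram law: as the sums are fixed, the potential of a pair depends
    only on the form at the differences.\<close>
  have double: "2 * (?\<Phi> a c + ?\<Phi> b d) = ?\<Phi> (a + b) (c + d) + ?\<Phi> (a - b) (c - d)" for a b c d :: int
    by (simp add: power2_eq_square algebra_simps)
  have sq: "m^2 \<le> x^2" if "0 \<le> m" "m \<le> \<bar>x\<bar>" for m x :: int
    using power_mono[OF that(2,1), of 2] by simp
  have "?\<Phi> (int x1 - int x2) (int y1 - int y2) \<le> 8"
  proof -
    define n b where "n = int x1 - int x2" and "b = int y1 - int y2"
    have "n \<in> {-1, 0, 1}" "b \<in> {-2, -1, 0, 1, 2}" "\<bar>n + b\<bar> \<le> 2"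
      using new by (auto simp: n_def b_def)
    then have "?\<Phi> n b \<le> 8" by (elim insertE emptyE; simp)
    then show ?thesis by (simp add: n_def b_def)
  qed
  moreover have "8 < ?\<Phi> (int u1 - int u2) (int v1 - int v2)"
  proof -
    define n b where "n = int u1 - int u2" and "b = int v1 - int v2"
    \<comment> \<open>If |n| \<le> 1, then |b| and |n + b| differ by at most 1, so when one of them
      is at least 3 the other is at least 2. This yields 9 + 4 > 8.\<close>
    have "2 \<le> \<bar>n\<bar> \<or> (2 \<le> \<bar>b\<bar> \<and> 3 \<le> \<bar>n + b\<bar>) \<or> (3 \<le> \<bar>b\<bar> \<and> 2 \<le> \<bar>n + b\<bar>)"
      using old by (auto simp: n_def b_def)
    then have "8 < ?\<Phi> n b"
    proof (elim disjE conjE)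
      assume "2 \<le> \<bar>n\<bar>"
      with sq[of 2 n] have "12 \<le> 3 * n^2" by simp
      then show ?thesis using zero_le_power2[of b] zero_le_power2[of "n + b"] by linarith
    next
      assume "2 \<le> \<bar>b\<bar>" "3 \<le> \<bar>n + b\<bar>"
      with sq[of 2 b] sq[of 3 "n + b"] have "4 \<le> b^2" "9 \<le> (n + b)^2" by simp_all
      then show ?thesis using zero_le_power2[of n] by linarith
    next
      assume "3 \<le> \<bar>b\<bar>" "2 \<le> \<bar>n + b\<bar>"
      with sq[of 3 b] sq[of 2 "n + b"] have "9 \<le> b^2" "4 \<le> (n + b)^2" by simp_all
      then show ?thesis using zero_le_power2[of n] by linarith
    qed
    then show ?thesis by (simp add: n_def b_def)
  qed
  moreover have "int x1 + int x2 = int u1 + int u2" "int y1 + int y2 = int v1 + int v2"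
    using sums by simp_all
  ultimately have "2 * (?\<Phi> (int x1) (int y1) + ?\<Phi> (int x2) (int y2))
      < 2 * (?\<Phi> (int u1) (int v1) + ?\<Phi> (int u2) (int v2))"
    unfolding double by simp
  then have "int ((3 * x1^2 + y1^2 + (x1 + y1)^2) + (3 * x2^2 + y2^2 + (x2 + y2)^2))
    < int ((3 * u1^2 + v1^2 + (u1 + v1)^2) + (3 * u2^2 + v2^2 + (u2 + v2)^2))"
    by simp
  then show ?thesis by (simp only: of_nat_less_iff)
qed

theorem theorem4:
  fixes D :: "('v, 'e) pre_digraph" and E :: "'e set" and ends :: "'e \<Rightarrow> 'v set" and k :: nat
  assumes "mixed_graph D E ends"
    and "k \<ge> 1"
    and "\<exists>F. mixed_edge_cover_partition D E ends k F"
  shows "\<exists>F. mixed_edge_cover_partition D E ends k F \<and>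
    (\<forall>i\<in>{1..k}. \<forall>j\<in>{1..k}.
       \<bar>int (card (F i)) - int (card (F j))\<bar> \<le> 2 \<and>
       \<bar>int (card (F i \<inter> E)) - int (card (F j \<inter> E))\<bar> \<le> 1 \<and>
       \<bar>int (card (F i \<inter> arcs D)) - int (card (F j \<inter> arcs D))\<bar> \<le> 2)"
proof -
  interpret mixed_graph D E ends by (rule assms(1))
  \<comment> \<open>Repairing one pair may unbalance others, so progress is measured by a sum over
    all parts. For a cover the last square is that of its size, written with both counts to match
    \<open>imbalance_less\<close>.\<close>
  define \<phi> where "\<phi> X = 3 * (card (X \<inter> E))^2 + (card (X \<inter> arcs D))^2
    + (card (X \<inter> E) + card (X \<inter> arcs D))^2" for X
  define \<Phi> where "\<Phi> F = (\<Sum>i\<in>{1..k}. \<phi> (F i))" for F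
  obtain F where F: "mixed_edge_cover_partition D E ends k F"
    and least: "\<And>F'. mixed_edge_cover_partition D E ends k F' \<Longrightarrow> \<Phi> F \<le> \<Phi> F'"
    using assms(3) ex_has_least_nat[of "mixed_edge_cover_partition D E ends k" _ \<Phi>] by blast
  have cover: "mixed_edge_cover D E ends (F i)" if "i \<in> {1..k}" for i
    using F that by (simp add: mixed_edge_cover_partition_def)
  have cardF: "card (F i) = card (F i \<inter> E) + card (F i \<inter> arcs D)" if "i \<in> {1..k}" for i
    using cover[OF that] by (intro card_eq_edges_plus_arcs) (simp add: mixed_edge_cover_def)
  have dis: "F i \<inter> F j = {}" if "i \<in> {1..k}" "j \<in> {1..k}" "i \<noteq> j" for i j
    using F that by (auto simp: mixed_edge_cover_partition_def disjoint_family_on_def)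
  have un: "(\<Union>i\<in>{1..k}. F i) = E \<union> arcs D"
    using F by (simp add: mixed_edge_cover_partition_def)
  have "\<bar>int (card (F i)) - int (card (F j))\<bar> \<le> 2 \<and>
       \<bar>int (card (F i \<inter> E)) - int (card (F j \<inter> E))\<bar> \<le> 1 \<and>
       \<bar>int (card (F i \<inter> arcs D)) - int (card (F j \<inter> arcs D))\<bar> \<le> 2"
    if ij: "i \<in> {1..k}" "j \<in> {1..k}" for i j
  proof (rule ccontr)
    assume unbalanced: "\<not> ?thesis"
    then have "i \<noteq> j" by auto
    obtain X Y where XY: "mixed_edge_cover D E ends X" "mixed_edge_cover D E ends Y"
      "X \<inter> Y = {}" "X \<union> Y = F i \<union> F j"
      "\<bar>int (card (X \<inter> E)) - int (card (Y \<inter> E))\<bar> \<le> 1"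
      "\<bar>int (card (X \<inter> arcs D)) - int (card (Y \<inter> arcs D))\<bar> \<le> 2"
      "\<bar>int (card X) - int (card Y)\<bar> \<le> 2"
      using balanced_pair[OF cover[OF ij(1)] cover[OF ij(2)] dis[OF ij \<open>i \<noteq> j\<close>]] by blast
    define F' where "F' = F(i := X, j := Y)"
    have F'ij: "F' i = X" "F' j = Y" using \<open>i \<noteq> j\<close> by (simp_all add: F'_def)
    have F'other: "F' l = F l" if "l \<notin> {i, j}" for l using that by (simp add: F'_def)
    have "mixed_edge_cover_partition D E ends k F'"
      unfolding mixed_edge_cover_partition_def
    proof (intro conjI ballI)
      show "mixed_edge_cover D E ends (F' l)" if "l \<in> {1..k}" for l
        using cover[OF that] XY(1,2) by (simp add: F'_def)
      show "disjoint_family_on F' {1..k}"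
        unfolding disjoint_family_on_def
      proof (intro ballI impI)
        fix l m assume lm: "l \<in> {1..k}" "m \<in> {1..k}" "l \<noteq> m"
        have away: "(X \<union> Y) \<inter> F l = {}" if "l \<in> {1..k}" "l \<notin> {i, j}" for l
          unfolding XY(4) using dis[OF ij(1) that(1)] dis[OF ij(2) that(1)] that(2) by auto
        show "F' l \<inter> F' m = {}"
          using lm away[of l] away[of m] dis[OF lm] XY(3) by (auto simp: F'_def)
      qed
      have split: "(\<Union>l\<in>{1..k}. H l) = (H i \<union> H j) \<union> (\<Union>l\<in>{1..k} - {i, j}. H l)" for H :: "nat \<Rightarrow> 'e set"
        using ij by blast
      have "(\<Union>l\<in>{1..k} - {i, j}. F' l) = (\<Union>l\<in>{1..k} - {i, j}. F l)"
        using F'other by (intro SUP_cong) auto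
      then have "(\<Union>l\<in>{1..k}. F' l) = (\<Union>l\<in>{1..k}. F l)"
        unfolding split[of F] split[of F'] F'ij XY(4) by (rule arg_cong)
      then show "(\<Union>l\<in>{1..k}. F' l) = E \<union> arcs D" unfolding un .
    qed
    then have "\<Phi> F \<le> \<Phi> F'" by (rule least)
    moreover have "\<Phi> F' < \<Phi> F"
    proof -
      have \<Phi>: "\<Phi> G = \<phi> (G i) + \<phi> (G j) + (\<Sum>l\<in>{1..k} - {i, j}. \<phi> (G l))" for G
      proof -
        have "\<Phi> G = (\<Sum>l\<in>{1..k} - {i, j}. \<phi> (G l)) + (\<Sum>l\<in>{i, j}. \<phi> (G l))"
          unfolding \<Phi>_def by (rule sum.subset_diff) (use ij in auto)
        then show ?thesis using \<open>i \<noteq> j\<close> by simp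
      qed
      have sums: "card (X \<inter> S) + card (Y \<inter> S) = card (F i \<inter> S) + card (F j \<inter> S)" if "finite S" for S
      proof -
        have "card (X \<inter> S) + card (Y \<inter> S) = card ((X \<union> Y) \<inter> S)"
          using XY(3) that by (subst card_Un_disjoint[symmetric]) (auto intro: arg_cong[of _ _ card])
        also have "\<dots> = card (F i \<inter> S) + card (F j \<inter> S)"
          unfolding XY(4) using dis[OF ij \<open>i \<noteq> j\<close>] that
          by (subst card_Un_disjoint[symmetric]) (auto intro: arg_cong[of _ _ card])
        finally show ?thesis .
      qed
      have "card X = card (X \<inter> E) + card (X \<inter> arcs D)" "card Y = card (Y \<inter> E) + card (Y \<inter> arcs D)"
        using XY(1,2) by (simp_all add: card_eq_edges_plus_arcs mixed_edge_cover_def)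
      then have "\<phi> X + \<phi> Y < \<phi> (F i) + \<phi> (F j)"
        unfolding \<phi>_def using XY(5-7) unbalanced cardF[OF ij(1)] cardF[OF ij(2)]
        by (intro imbalance_less sums finite_edges finite_arcs) auto
      moreover have "(\<Sum>l\<in>{1..k} - {i, j}. \<phi> (F' l)) = (\<Sum>l\<in>{1..k} - {i, j}. \<phi> (F l))"
        using F'other by (intro sum.cong) auto
      ultimately show ?thesis unfolding \<Phi> F'ij by simp
    qed
    ultimately show False by simp
  qed
  with F show ?thesis by blast
qed

end
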